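(* Let $m,n\in\mathbb{N}$ be fixed positive integers. Consider a sequence of $m\times n$ contingency tables $(x_{ij})_{1\le i\le m,\,1\le j\le n}$ of non-negative integer cell counts (depending on the table in the sequence), with total sample size $N=\sum_{i,j}x_{ij}\to\infty$ along the sequence. Assume that, for all $i,j$, the proportions $x_{ij}/N$ converge along the sequence to a limit $p_{ij}$ with $p_{ij}>0$. Let $P_H$ be the hypergeometric probability of the table $(x_{ij})$ given its marginal totals, and let $MI$ be the mutual information computed from the empirical proportions $x_{ij}/N$. Then, as $N\to\infty$ along the sequence, $$-\frac{1}{N}\log P_H = MI + O\!\left(\frac{\log(N+1)}{N}\right).$$
   Context: All logarithms are natural. For an $m\times n$ table $x=(x_{ij})$ of non-negative integers with total $N$, write $a_i=\sum_{j=1}^n x_{ij}$ and $b_j=\sum_{i=1}^m x_{ij}$ for the marginal totals. The hypergeometric probability of the observed table is $$P_H=\frac{\prod_{i=1}^m a_i!\,\prod_{j=1}^n b_j!}{N!\,\prod_{i,j}x_{ij}!}.$$ The empirical mutual information is $$MI=\sum_{i=1}^m\sum_{j=1}^n \frac{x_{ij}}{N}\log\frac{x_{ij}/N}{(a_i/N)(b_j/N)},$$ with the convention that terms with $x_{ij}=0$ equal $0$. Both $P_H$ and $MI$ depend on the table in the sequence. The notation $O(\log(N+1)/N)$ means that the absolute value of the error is at most a constant (independent of $N$ along the sequence) times $\log(N+1)/N$ for all sufficiently large $N$. *)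

theory Defs
  imports Complex_Main "HOL-Library.Landau_Symbols"
begin

text \<open>
  An \<open>m \<times> n\<close> table is a function \<open>x :: nat \<Rightarrow> nat \<Rightarrow> nat\<close> of which only the entries
  \<open>x i j\<close> with \<open>1 \<le> i \<le> m\<close> and \<open>1 \<le> j \<le> n\<close> are relevant.
\<close>

definition row_total :: "nat \<Rightarrow> (nat \<Rightarrow> nat \<Rightarrow> nat) \<Rightarrow> nat \<Rightarrow> nat" where
  "row_total n x i = (\<Sum>j=1..n. x i j)"

definition col_total :: "nat \<Rightarrow> (nat \<Rightarrow> nat \<Rightarrow> nat) \<Rightarrow> nat \<Rightarrow> nat" where
  "col_total m x j = (\<Sum>i=1..m. x i j)"

definition table_total :: "nat \<Rightarrow> nat \<Rightarrow> (nat \<Rightarrow> nat \<Rightarrow> nat) \<Rightarrow> nat" where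
  "table_total m n x = (\<Sum>i=1..m. \<Sum>j=1..n. x i j)"

definition hypergeometric_prob :: "nat \<Rightarrow> nat \<Rightarrow> (nat \<Rightarrow> nat \<Rightarrow> nat) \<Rightarrow> real" where
  "hypergeometric_prob m n x =
     ((\<Prod>i=1..m. fact (row_total n x i)) * (\<Prod>j=1..n. fact (col_total m x j))) /
     (fact (table_total m n x) * (\<Prod>i=1..m. \<Prod>j=1..n. fact (x i j)))"

text \<open>
  A cell with \<open>x i j = 0\<close> contributes \<open>0\<close> because of the factor \<open>x i j / N\<close>, whatever the
  value of the logarithm.
\<close>

definition mutual_info :: "nat \<Rightarrow> nat \<Rightarrow> (nat \<Rightarrow> nat \<Rightarrow> nat) \<Rightarrow> real" where
  "mutual_info m n x =
     (let N = real (table_total m n x) in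
       \<Sum>i=1..m. \<Sum>j=1..n.
         real (x i j) / N *
         ln ((real (x i j) / N) /
             ((real (row_total n x i) / N) * (real (col_total m x j) / N))))"

end

theory Submission
  imports Defs
begin

text \<open>
  Write \<open>ln n! = n ln n - n + h(n)\<close>, where \<open>0 \<le> h(n) \<le> 1 + ln (n + 1)\<close>. In \<open>- ln P\<^sub>H\<close> the linear terms
  cancel because each margin sums to \<open>N\<close>, and the terms \<open>n ln n\<close> add up to exactly \<open>N\<close> times the
  mutual information. What is left is a signed sum of \<open>1 + m + n + m n\<close> values of \<open>h\<close> at arguments
  of at most \<open>N\<close>, each of which is \<open>O(ln (N + 1))\<close>.
\<close>

text \<open>This is the \<open>h\<close> of the overview. At \<open>0\<close> the factor
  \<open>real n\<close> removes the logarithm, so the value there is 0, in line with the convention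
  0 ln 0 = 0.\<close>

definition stirling_error :: "nat \<Rightarrow> real" where
  "stirling_error n = ln (fact n) - (real n * ln (real n) - real n)"

lemma ln_one_plus_inverse_of_nat:
  assumes "n > 0"
  shows "ln (1 + 1 / real n) = ln (real (Suc n)) - ln (real n)"
proof -
  have "1 + 1 / real n = real (Suc n) / real n"
    using assms by (simp add: field_simps)
  then show ?thesis
    using assms by (simp add: ln_div)
qed

text \<open>The new summand \<open>ln (Suc n)\<close> of the log-factorial cancels one of the
  \<open>Suc n\<close> copies of \<open>ln (Suc n)\<close>; the other \<open>n\<close> pair up with
  the \<open>n\<close> copies of \<open>ln n\<close>.\<close>

lemma stirling_error_Suc_diff:
  assumes "n > 0"
  shows "stirling_error (Suc n) - stirling_error n = 1 - real n * ln (1 + 1 / real n)"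
proof -
  have "ln (fact (Suc n) :: real) = ln (real (Suc n)) + ln (fact n)"
    unfolding fact_Suc by (subst ln_mult) auto
  then show ?thesis
    unfolding stirling_error_def ln_one_plus_inverse_of_nat [OF assms] by (simp add: algebra_simps)
qed

text \<open>With L = ln (1 + 1/n), the estimates 1/(n+1) \<le> L \<le> 1/n place the increment 1 - n
  L between 0 and L. Since L is also the increment of \<open>ln n\<close>, both bounds pass from
  \<open>n\<close> to \<open>Suc n\<close>. At 1 the upper bound is attained.\<close>

lemma stirling_error_bounds_pos:
  assumes "n > 0"
  shows "0 \<le> stirling_error n \<and> stirling_error n \<le> 1 + ln (real n)"
  using assms
proof (induction n rule: nat_induct_non_zero)
  case 1
  show ?case by (simp add: stirling_error_def)
next
  case (Suc n)
  define L where "L = ln (1 + 1 / real n)"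
  have "L \<le> 1 / real n"
    unfolding L_def by (rule ln_add_one_self_le_self) simp
  then have "real n * L \<le> 1"
    using Suc.hyps by (simp add: field_simps)
  moreover have "1 \<le> (real n + 1) * L"
  proof -
    \<comment> \<open>The lower estimate for L is ln y \<le> y - 1 at y = n/(n+1), the reciprocal of
      1 + 1/n.\<close>
    have "- L = ln (real n / (real n + 1))"
      using Suc.hyps unfolding L_def by (subst ln_inverse [symmetric]) (auto simp: field_simps)
    also have "\<dots> \<le> real n / (real n + 1) - 1"
      using Suc.hyps by (intro ln_le_minus_one) simp
    finally show ?thesis by (simp add: field_simps)
  qed
  moreover have "ln (real (Suc n)) = ln (real n) + L"
    using ln_one_plus_inverse_of_nat [OF Suc.hyps] by (simp add: L_def)
  ultimately show ?case
    using Suc.IH stirling_error_Suc_diff [OF Suc.hyps] unfolding L_def [symmetric]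
    by (simp add: algebra_simps)
qed

text \<open>Serves to bound the error at every cell and margin by one quantity depending on the
  grand total \<open>M\<close> alone.\<close>

lemma abs_stirling_error_le:
  assumes "n \<le> M"
  shows "\<bar>stirling_error n\<bar> \<le> 1 + ln (real M + 1)"
proof (cases "n = 0")
  case True
  then show ?thesis by (simp add: stirling_error_def)
next
  case False
  then have "ln (real n) \<le> ln (real M + 1)"
    using assms by (intro ln_mono) auto
  then show ?thesis
    using stirling_error_bounds_pos [of n] False by linarith
qed

lemma sum_row_total: "(\<Sum>i=1..m. row_total n x i) = table_total m n x"
  by (simp add: row_total_def table_total_def)

lemma sum_col_total: "(\<Sum>j=1..n. col_total m x j) = table_total m n x"
  unfolding col_total_def table_total_def by (rule sum.swap)

lemma entry_le_row_total: "j \<in> {1..n} \<Longrightarrow> x i j \<le> row_total n x i"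
  unfolding row_total_def by (rule member_le_sum) auto

lemma entry_le_col_total: "i \<in> {1..m} \<Longrightarrow> x i j \<le> col_total m x j"
  unfolding col_total_def by (rule member_le_sum [where f = "\<lambda>i. x i j"]) auto

lemma row_total_le_table_total: "i \<in> {1..m} \<Longrightarrow> row_total n x i \<le> table_total m n x"
  unfolding sum_row_total [symmetric] by (rule member_le_sum) auto

lemma col_total_le_table_total: "j \<in> {1..n} \<Longrightarrow> col_total m x j \<le> table_total m n x"
  unfolding sum_col_total [symmetric] by (rule member_le_sum) auto

lemma ln_hypergeometric_prob:
  "ln (hypergeometric_prob m n x) =
     (\<Sum>i=1..m. ln (fact (row_total n x i))) + (\<Sum>j=1..n. ln (fact (col_total m x j)))
     - ln (fact (table_total m n x)) - (\<Sum>i=1..m. \<Sum>j=1..n. ln (fact (x i j)))"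
proof -
  have "(\<Prod>i=1..m. \<Prod>j=1..n. fact (x i j) :: real) > 0"
    "(\<Prod>i=1..m. fact (row_total n x i) :: real) > 0"
    "(\<Prod>j=1..n. fact (col_total m x j) :: real) > 0"
    by (auto intro!: prod_pos)
  moreover have "ln (\<Prod>i=1..m. \<Prod>j=1..n. fact (x i j) :: real) =
      (\<Sum>i=1..m. \<Sum>j=1..n. ln (fact (x i j)))"
    by (subst ln_prod) (auto intro!: prod_pos sum.cong ln_prod)
  ultimately show ?thesis
    unfolding hypergeometric_prob_def
    by (simp add: ln_div ln_mult ln_prod)
qed

text \<open>Each cell's logarithm splits into four terms. A term whose logarithm depends on one
  margin only, or on \<open>N\<close> only, collapses on summation because the cells add up to that
  total.\<close>

lemma total_mult_mutual_info:
  assumes "table_total m n x > 0"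
  shows "real (table_total m n x) * mutual_info m n x =
     (\<Sum>i=1..m. \<Sum>j=1..n. real (x i j) * ln (real (x i j)))
     + real (table_total m n x) * ln (real (table_total m n x))
     - (\<Sum>i=1..m. real (row_total n x i) * ln (real (row_total n x i)))
     - (\<Sum>j=1..n. real (col_total m x j) * ln (real (col_total m x j)))"
proof -
  define N where "N = real (table_total m n x)"
  have "N > 0" using assms by (simp add: N_def)
  have cell: "N * (real (x i j) / N *
         ln ((real (x i j) / N) / ((real (row_total n x i) / N) * (real (col_total m x j) / N)))) =
       real (x i j) * ln (real (x i j)) + real (x i j) * ln N
       - real (x i j) * ln (real (row_total n x i)) - real (x i j) * ln (real (col_total m x j))"
    if "i \<in> {1..m}" "j \<in> {1..n}" for i j
  \<comment> \<open>An empty cell gives 0 on both sides. A nonempty one forces both of its margins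
    to be positive, so the logarithm may be split.\<close>
  proof (cases "x i j = 0")
    case False
    then have "row_total n x i > 0" "col_total m x j > 0"
      using entry_le_row_total [OF that(2), of x i] entry_le_col_total [OF that(1), of x j] by auto
    with False \<open>N > 0\<close> show ?thesis
      by (simp add: ln_div ln_mult algebra_simps)
  qed simp
  have "N * mutual_info m n x =
     (\<Sum>i=1..m. \<Sum>j=1..n. real (x i j) * ln (real (x i j)) + real (x i j) * ln N
       - real (x i j) * ln (real (row_total n x i)) - real (x i j) * ln (real (col_total m x j)))"
    unfolding mutual_info_def Let_def N_def [symmetric] sum_distrib_left
    by (intro sum.cong refl cell)
  also have "\<dots> = (\<Sum>i=1..m. \<Sum>j=1..n. real (x i j) * ln (real (x i j)))
     + (\<Sum>i=1..m. \<Sum>j=1..n. real (x i j) * ln N)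
     - (\<Sum>i=1..m. \<Sum>j=1..n. real (x i j) * ln (real (row_total n x i)))
     - (\<Sum>i=1..m. \<Sum>j=1..n. real (x i j) * ln (real (col_total m x j)))"
    by (simp add: sum.distrib sum_subtractf)
  also have "(\<Sum>i=1..m. \<Sum>j=1..n. real (x i j) * ln N) = N * ln N"
    by (simp add: N_def table_total_def sum_distrib_right)
  also have "(\<Sum>i=1..m. \<Sum>j=1..n. real (x i j) * ln (real (row_total n x i))) =
      (\<Sum>i=1..m. real (row_total n x i) * ln (real (row_total n x i)))"
    by (simp add: row_total_def sum_distrib_right)
  also have "(\<Sum>i=1..m. \<Sum>j=1..n. real (x i j) * ln (real (col_total m x j))) =
      (\<Sum>j=1..n. real (col_total m x j) * ln (real (col_total m x j)))"
    \<comment> \<open>The column factor is constant in \<open>i\<close>, so the sum over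
      \<open>i\<close> has to become the inner one.\<close>
    by (subst sum.swap) (simp add: col_total_def sum_distrib_right)
  finally show ?thesis by (simp add: N_def)
qed

text \<open>Rows and columns enter \<open>ln P\<close> with sign +, the grand total and the cells
  with sign -. Each of these four groups has linear part -N, so the linear parts cancel, and the k
  ln k parts form \<open>N\<close> times the mutual information.\<close>

lemma neg_ln_hypergeometric_prob_eq:
  assumes "table_total m n x > 0"
  shows "- ln (hypergeometric_prob m n x) - real (table_total m n x) * mutual_info m n x =
     stirling_error (table_total m n x) + (\<Sum>i=1..m. \<Sum>j=1..n. stirling_error (x i j))
     - (\<Sum>i=1..m. stirling_error (row_total n x i)) - (\<Sum>j=1..n. stirling_error (col_total m x j))"
proof -
  have "(\<Sum>i=1..m. real (row_total n x i)) = real (table_total m n x)"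
    "(\<Sum>j=1..n. real (col_total m x j)) = real (table_total m n x)"
    "(\<Sum>i=1..m. \<Sum>j=1..n. real (x i j)) = real (table_total m n x)"
    by (simp_all only: of_nat_sum [symmetric] sum_row_total sum_col_total table_total_def)
  then show ?thesis
    unfolding ln_hypergeometric_prob total_mult_mutual_info [OF assms] stirling_error_def
    by (simp add: sum.distrib sum_subtractf)
qed

text \<open>The triangle inequality over all error terms: one for the grand total,
  \<open>m * n\<close> for the cells, \<open>m\<close> for the rows and \<open>n\<close> for the
  columns.\<close>

lemma neg_ln_hypergeometric_prob_bound:
  assumes "table_total m n x > 0"
  shows "\<bar>- ln (hypergeometric_prob m n x) - real (table_total m n x) * mutual_info m n x\<bar> \<le>
     real (1 + m * n + m + n) * (1 + ln (real (table_total m n x) + 1))"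
proof -
  define B where "B = 1 + ln (real (table_total m n x) + 1)"
  have bound: "\<bar>stirling_error k\<bar> \<le> B" if "k \<le> table_total m n x" for k
    using abs_stirling_error_le [OF that] by (simp add: B_def)
  have "\<bar>\<Sum>i=1..m. \<Sum>j=1..n. stirling_error (x i j)\<bar> \<le> (\<Sum>i=1..m. \<Sum>j=1..n. B)"
    by (intro order_trans [OF sum_abs] sum_mono bound
          order_trans [OF entry_le_row_total row_total_le_table_total])
  moreover have "\<bar>\<Sum>i=1..m. stirling_error (row_total n x i)\<bar> \<le> (\<Sum>i=1..m. B)"
    by (intro order_trans [OF sum_abs] sum_mono bound row_total_le_table_total)
  moreover have "\<bar>\<Sum>j=1..n. stirling_error (col_total m x j)\<bar> \<le> (\<Sum>j=1..n. B)"
    by (intro order_trans [OF sum_abs] sum_mono bound col_total_le_table_total)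
  moreover have "real (1 + m * n + m + n) * B = B + real m * (real n * B) + real m * B + real n * B"
    by (simp add: algebra_simps)
  ultimately show ?thesis
    using bound [OF order_refl]
    unfolding neg_ln_hypergeometric_prob_eq [OF assms] B_def [symmetric]
    by simp
qed

theorem mainTheorem2:
  fixes m n :: nat
    and x :: "nat \<Rightarrow> nat \<Rightarrow> nat \<Rightarrow> nat"
    and p :: "nat \<Rightarrow> nat \<Rightarrow> real"
    and N :: "nat \<Rightarrow> nat"
  defines "N \<equiv> \<lambda>k. table_total m n (x k)"
  assumes "m > 0" and "n > 0"
    and "filterlim N at_top sequentially"
    and "\<And>i j. i \<in> {1..m} \<Longrightarrow> j \<in> {1..n} \<Longrightarrow>
           (\<lambda>k. real (x k i j) / real (N k)) \<longlonglongrightarrow> p i j"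
    and "\<And>i j. i \<in> {1..m} \<Longrightarrow> j \<in> {1..n} \<Longrightarrow> p i j > 0"
  shows "(\<lambda>k. - (1 / real (N k)) * ln (hypergeometric_prob m n (x k)) - mutual_info m n (x k))
           \<in> O(\<lambda>k. ln (real (N k) + 1) / real (N k))"
proof (rule bigoI)
  define C where "C = real (1 + m * n + m + n)"
  \<comment> \<open>From \<open>N k \<ge> 2\<close> on, N + 1 \<ge> 3 \<ge> e, so ln (N + 1) \<ge>
    1. This absorbs the summand 1 of the bound and accounts for the factor 2 in
    \<open>2 * C\<close>.\<close>
  have "eventually (\<lambda>k. N k \<ge> 2) sequentially"
    using assms(4) by (simp add: filterlim_at_top)
  then show "eventually (\<lambda>k. norm (- (1 / real (N k)) * ln (hypergeometric_prob m n (x k))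
      - mutual_info m n (x k)) \<le> (2 * C) * norm (ln (real (N k) + 1) / real (N k))) sequentially"
  proof eventually_elim
    case (elim k)
    define D where "D = - ln (hypergeometric_prob m n (x k)) - real (N k) * mutual_info m n (x k)"
    have "exp 1 \<le> real (N k) + 1"
      using exp_le elim by linarith
    then have "1 \<le> ln (real (N k) + 1)"
      by (subst ln_ge_iff) auto
    moreover have "\<bar>D\<bar> \<le> C * (1 + ln (real (N k) + 1))"
      using neg_ln_hypergeometric_prob_bound [of m n "x k"] elim by (simp add: D_def C_def N_def)
    moreover have "C * (1 + ln (real (N k) + 1)) \<le> C * (2 * ln (real (N k) + 1))"
      using \<open>1 \<le> ln (real (N k) + 1)\<close> by (intro mult_left_mono) (auto simp: C_def)
    ultimately have "\<bar>D\<bar> / real (N k) \<le> 2 * C * \<bar>ln (real (N k) + 1)\<bar> / real (N k)"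
      by (intro divide_right_mono) auto
    moreover have "- (1 / real (N k)) * ln (hypergeometric_prob m n (x k)) - mutual_info m n (x k)
        = D / real (N k)"
      using elim by (simp add: D_def field_simps)
    ultimately show ?case by (simp add: abs_divide)
  qed
qed

end
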